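(* Let $(X,\|\cdot,\cdot\|)$ be a linear $2$-normed space, let $G\subset X$, and let $W$ be a nonempty bounded subset of $X$. Let $g_1,g_2\in G$, let $\lambda_1,\lambda_2\in[0,1]$ with $\lambda_1+\lambda_2=1$, and put $g=\lambda_1g_1+\lambda_2g_2$. Let $b\in X$ be such that $b\notin L\{f,h\}$ for every $f\in W$ and every $h\in\{g_1,g_2,g\}$. If $g_1$ and $g_2$ are best simultaneous approximations to $W$ by elements of $G$ (with respect to $b$), then $g$ is also a best simultaneous approximation to $W$ by elements of $G$ (with respect to $b$).
   Context: A linear 2-normed space is a linear space $X$ over $F$ ($F=\mathbb{R}$ or $\mathbb{C}$), with $\dim X>1$, together with a function $\|\cdot,\cdot\|:X\times X\to[0,\infty)$ such that: (N1) $\|x,y\|=0$ if and only if $x$ and $y$ are linearly dependent; (N2) $\|x,y\|=\|y,x\|$; (N3) $\|\alpha x,y\|=|\alpha|\,\|x,y\|$ for all scalars $\alpha$; (N4) $\|x+y,z\|\le\|x,z\|+\|y,z\|$, for all $x,y,z\in X$. A subset $W\subset X$ is bounded if $\sup_{f\in W}\|f,c\|<\infty$ for every $c\in X$. $L\{f,h\}$ denotes the linear subspace of $X$ generated by $f$ and $h$. Given a bounded set $W\subset X$, a set $G\subset X$ and $b\in X$, an element $g^{*}\in G$ is called a best (simultaneous) approximation to $W$ by elements of $G$ with respect to $b$ if $b\notin L\{f,g^{*}\}$ for $f\in W$ and $$\sup_{f\in W}\|f-g^{*},b\|=\inf_{g'\in G}\ \sup_{f\in W}\|f-g',b\|.$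$
   Formalization: The formal statement additionally assumes that g lies in G (automatic if G is convex); without this the claim fails, e.g. in R^3 with ||x,y||=|x×y|, W={0}, b=e3, G={e1,-e1}, g=0. *)

theory Defs
  imports Complex_Main
begin

text \<open>
  The scalars range over a type of class \<^class>\<open>real_normed_field\<close>. Besides the instances
  \<^typ>\<open>real\<close> and \<^typ>\<open>complex\<close> this admits no other field: a commutative real division algebra
  with a multiplicative norm is isometrically isomorphic to one of these two.

  Linear dependence in \<open>N1\<close> is that of the pair \<open>(x, y)\<close>, not of the set \<open>{x, y}\<close>:
  for \<open>x = y \<noteq> 0\<close> the pair is dependent although the set has just one, nonzero, element.

  The dimension condition is stated through a basis because \<^const>\<open>vector_space.dim\<close> is 0
  for infinite-dimensional spaces.
\<close>

locale two_normed_space = vector_space scale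
  for scale :: "'k::real_normed_field \<Rightarrow> 'a::ab_group_add \<Rightarrow> 'a" (infixr \<open>*s\<close> 75) +
  fixes tnorm :: "'a \<Rightarrow> 'a \<Rightarrow> real"
  assumes dim_gt_1: "\<exists>B. independent B \<and> span B = UNIV \<and> (infinite B \<or> card B > 1)"
    and nonneg: "tnorm x y \<ge> 0"
    and N1: "tnorm x y = 0 \<longleftrightarrow> (\<exists>\<alpha> \<beta>. (\<alpha> \<noteq> 0 \<or> \<beta> \<noteq> 0) \<and> \<alpha> *s x + \<beta> *s y = 0)"
    and N2: "tnorm x y = tnorm y x"
    and N3: "tnorm (\<alpha> *s x) y = norm \<alpha> * tnorm x y"
    and N4: "tnorm (x + y) z \<le> tnorm x z + tnorm y z"
begin

definition bounded_set :: "'a set \<Rightarrow> bool" where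
  "bounded_set W \<longleftrightarrow> (\<forall>c. bdd_above ((\<lambda>f. tnorm f c) ` W))"

text \<open>
  Meant for nonempty bounded \<open>W\<close>; then the real-valued suprema are over nonempty
  bounded sets, and the infimum is over a nonempty set bounded below by 0.
\<close>

definition best_approx :: "'a set \<Rightarrow> 'a set \<Rightarrow> 'a \<Rightarrow> 'a \<Rightarrow> bool" where
  "best_approx W G b g \<longleftrightarrow>
     g \<in> G \<and> (\<forall>f\<in>W. b \<notin> span {f, g}) \<and>
     (SUP f\<in>W. tnorm (f - g) b) = (INF g'\<in>G. SUP f\<in>W. tnorm (f - g') b)"

end

end

theory Submission
  imports Defs
begin

text \<open>
  The reason is convexity. The deviation \<open>\<rho> h = (SUP f\<in>W. \<parallel>f - h, b\<parallel>)\<close> is a supremum of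
  functions \<open>h \<mapsto> \<parallel>f - h, b\<parallel>\<close>, each of which is convex because \<open>\<parallel>\<cdot>, b\<parallel>\<close> is a seminorm; so
  \<open>\<rho>\<close> is convex (\<open>deviation_convex\<close>). Apart from the condition that \<open>b\<close> avoid the
  spans, being a best approximation means being a point of \<open>G\<close> where \<open>\<rho>\<close> attains its
  infimum over \<open>G\<close>. If it is attained at \<open>g1\<close> and \<open>g2\<close>, then the value of
  \<open>\<rho>\<close> at a convex combination lying in \<open>G\<close> is at most that infimum, and at least
  that infimum because the point is in \<open>G\<close> (\<open>INF_deviation_le\<close>).

  Since suprema and infima are real-valued, both steps rest on the boundedness of the
  sets involved: that of \<open>W\<close>, which passes to its translates, and the lower bound 0.
\<close>

context two_normed_space
begin

text \<open>
  By N4, translating by \<open>h\<close> raises the bound for \<open>W\<close> by at most the constant \<open>\<parallel>- h, b\<parallel>\<close>.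
  This is what makes every deviation a genuine supremum.
\<close>

lemma bdd_above_deviation:
  assumes "bounded_set W"
  shows "bdd_above ((\<lambda>f. tnorm (f - h) b) ` W)"
proof -
  obtain M where M: "\<And>f. f \<in> W \<Longrightarrow> tnorm f b \<le> M"
    using assms unfolding bounded_set_def bdd_above_def by blast
  have "tnorm (f - h) b \<le> M + tnorm (- h) b" if "f \<in> W" for f
    using N4[of f "- h" b] M[OF that] by simp
  then show ?thesis by (intro bdd_aboveI2)
qed

lemma tnorm_le_deviation:
  assumes "bounded_set W" and "f \<in> W"
  shows "tnorm (f - h) b \<le> (SUP f\<in>W. tnorm (f - h) b)"
  using assms(2) bdd_above_deviation[OF assms(1)] by (rule cSUP_upper)

text \<open>
  Because \<open>s + t = 1\<close>, the point \<open>f\<close> splits as \<open>s f + t f\<close>, so the difference is the same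
  combination of \<open>f - x\<close> and \<open>f - y\<close>, to which N4 and N3 apply.
\<close>

lemma tnorm_diff_convex:
  assumes "0 \<le> s" "0 \<le> t" "s + t = 1"
  shows "tnorm (f - (of_real s *s x + of_real t *s y)) b
    \<le> s * tnorm (f - x) b + t * tnorm (f - y) b"
proof -
  have "f = of_real (s + t) *s f" by (simp add: assms(3))
  also have "\<dots> = of_real s *s f + of_real t *s f"
    unfolding of_real_add by (rule scale_left_distrib)
  finally have "f - (of_real s *s x + of_real t *s y)
      = (of_real s *s f + of_real t *s f) - (of_real s *s x + of_real t *s y)"
    by (rule arg_cong)
  also have "\<dots> = of_real s *s (f - x) + of_real t *s (f - y)"
    unfolding scale_right_diff_distrib by (rule add_diff_add)
  finally have "f - (of_real s *s x + of_real t *s y)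
      = of_real s *s (f - x) + of_real t *s (f - y)" .
  then show ?thesis
    using N4[of "of_real s *s (f - x)" "of_real t *s (f - y)" b] assms(1,2)
    by (simp add: N3)
qed

lemma deviation_convex:
  assumes "bounded_set W" "W \<noteq> {}" and "0 \<le> s" "0 \<le> t" "s + t = 1"
  shows "(SUP f\<in>W. tnorm (f - (of_real s *s x + of_real t *s y)) b)
    \<le> s * (SUP f\<in>W. tnorm (f - x) b) + t * (SUP f\<in>W. tnorm (f - y) b)"
proof (rule cSUP_least[OF assms(2)])
  fix f assume f: "f \<in> W"
  have "tnorm (f - (of_real s *s x + of_real t *s y)) b
      \<le> s * tnorm (f - x) b + t * tnorm (f - y) b"
    using assms(3-5) by (rule tnorm_diff_convex)
  also have "\<dots> \<le> s * (SUP f\<in>W. tnorm (f - x) b) + t * (SUP f\<in>W. tnorm (f - y) b)"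
    using tnorm_le_deviation[OF assms(1) f] assms(3,4)
    by (intro add_mono mult_left_mono)
  finally show "tnorm (f - (of_real s *s x + of_real t *s y)) b \<le> \<dots>" .
qed

lemma INF_deviation_le:
  assumes "bounded_set W" "W \<noteq> {}" and "g \<in> G"
  shows "(INF g'\<in>G. SUP f\<in>W. tnorm (f - g') b) \<le> (SUP f\<in>W. tnorm (f - g) b)"
proof (rule cINF_lower[OF _ assms(3)])
  obtain f where "f \<in> W" using assms(2) by blast
  then have "0 \<le> (SUP f\<in>W. tnorm (f - g') b)" for g'
    by (rule order_trans[OF nonneg tnorm_le_deviation[OF assms(1)]])
  then show "bdd_below ((\<lambda>g'. SUP f\<in>W. tnorm (f - g') b) ` G)"
    by (intro bdd_belowI2)
qed

lemma best_approx_convex_combination: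
  assumes W: "bounded_set W" "W \<noteq> {}"
    and st: "0 \<le> s" "0 \<le> t" "s + t = 1"
    and g: "g = of_real s *s g1 + of_real t *s g2" "g \<in> G"
    and b: "\<forall>f\<in>W. b \<notin> span {f, g}"
    and best: "best_approx W G b g1" "best_approx W G b g2"
  shows "best_approx W G b g"
proof -
  let ?r = "\<lambda>h. SUP f\<in>W. tnorm (f - h) b"
  let ?d = "INF g'\<in>G. ?r g'"
  have "?r g \<le> s * ?r g1 + t * ?r g2"
    unfolding g(1) using W st by (rule deviation_convex)
  also have "\<dots> = s * ?d + t * ?d"
    using best by (simp add: best_approx_def)
  also have "\<dots> = ?d"
    using st(3) by (simp flip: distrib_right)
  finally have "?r g = ?d"
    using INF_deviation_le[OF W g(2)] by (rule antisym)
  then show ?thesis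
    using g(2) b by (simp add: best_approx_def)
qed

end

theorem lemma4:
  fixes scale :: "'k::real_normed_field \<Rightarrow> 'a::ab_group_add \<Rightarrow> 'a"
    and tnorm :: "'a \<Rightarrow> 'a \<Rightarrow> real"
    and G W :: "'a set"
    and g1 g2 g b :: 'a
    and l1 l2 :: real
  assumes "two_normed_space scale tnorm"
    and "W \<noteq> {}"
    and "two_normed_space.bounded_set tnorm W"
    and "g1 \<in> G" and "g2 \<in> G"
    and "l1 \<in> {0..1}" and "l2 \<in> {0..1}" and "l1 + l2 = 1"
    and "g = scale (of_real l1) g1 + scale (of_real l2) g2"
    and "g \<in> G"
    and "\<forall>f\<in>W. \<forall>h\<in>{g1, g2, g}. b \<notin> module.span scale {f, h}"
    and "two_normed_space.best_approx scale tnorm W G b g1"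
    and "two_normed_space.best_approx scale tnorm W G b g2"
  shows "two_normed_space.best_approx scale tnorm W G b g"
proof -
  interpret two_normed_space scale tnorm by fact
  have "0 \<le> l1" "0 \<le> l2" and "\<forall>f\<in>W. b \<notin> span {f, g}"
    using assms(6,7,11) by simp_all
  then show ?thesis
    using assms(2,3,8-10,12,13) by (intro best_approx_convex_combination[of W l1 l2 g g1 g2])
qed

end
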